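(* Fix a positive integer $m$. Let $A$ and $B$ be matrices in $\mathcal{S}=\mathrm{SL}(2,2^m)$. Then exactly one of the following holds: (i) $A^{\mathcal{S}}B^{\mathcal{S}}=(AB)^{\mathcal{S}}$ and at least one of $A$, $B$ is a scalar matrix. (ii) $A^{\mathcal{S}}B^{\mathcal{S}}$ is the union of at least $2^m-1$ distinct conjugacy classes of $\mathcal{S}$, i.e. $\eta(A^{\mathcal{S}}B^{\mathcal{S}})\ge 2^m-1$.
   Context: $\mathrm{SL}(2,q)$ is the group of $2\times 2$ matrices of determinant $1$ over the finite field with $q$ elements. For a finite group $\mathcal{G}$ and $A\in\mathcal{G}$, $A^{\mathcal{G}}=\{A^B\mid B\in\mathcal{G}\}$, where $A^B=B^{-1}AB$, is the conjugacy class of $A$ in $\mathcal{G}$. The product of two classes is $A^{\mathcal{G}}B^{\mathcal{G}}=\{XY\mid X\in A^{\mathcal{G}},\,Y\in B^{\mathcal{G}}\}$. This set is invariant under conjugation by $\mathcal{G}$, hence a union of distinct conjugacy classes of $\mathcal{G}$. For a conjugation-invariant subset $\mathcal{X}$ of $\mathcal{G}$, $\eta(\mathcal{X})$ denotes the number of distinct conjugacy classes of $\mathcal{G}$ whose union is $\mathcal{X}$.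
   Formalization: For m=1 "exactly one" is false: with A=B the identity, η=1=2^1-1, so (i) and (ii) both hold. The formal theorem states that at least one of (i), (ii) holds for every m≥1, and that they exclude each other for m≥2. *)

theory Defs
  imports "HOL-Analysis.Determinants" "HOL-Algebra.Coset"
begin

definition conj_class :: "('a, 'b) monoid_scheme \<Rightarrow> 'a \<Rightarrow> 'a set" where
  "conj_class G a = {inv\<^bsub>G\<^esub> b \<otimes>\<^bsub>G\<^esub> a \<otimes>\<^bsub>G\<^esub> b | b. b \<in> carrier G}"

definition conj_classes :: "('a, 'b) monoid_scheme \<Rightarrow> 'a set set" where
  "conj_classes G = conj_class G ` carrier G"

definition conj_invariant :: "('a, 'b) monoid_scheme \<Rightarrow> 'a set \<Rightarrow> bool" where
  "conj_invariant G X \<longleftrightarrow> X \<subseteq> carrier G \<and> (\<forall>x\<in>X. conj_class G x \<subseteq> X)"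

text \<open>For a conjugation-invariant set X the classes contained in X are the only family of
  conjugacy classes whose union is X; see the lemmas \<open>Union_conj_classes\<close> and \<open>eta_eq_card\<close> below.\<close>

definition eta :: "('a, 'b) monoid_scheme \<Rightarrow> 'a set \<Rightarrow> nat" where
  "eta G X = card {C \<in> conj_classes G. C \<subseteq> X}"

definition SL :: "('f::field ^ 'n ^ 'n) monoid" where
  "SL = \<lparr>carrier = {M. det M = 1}, mult = (**), one = mat 1\<rparr>"

definition scalar_matrix :: "'f::field ^ 'n ^ 'n \<Rightarrow> bool" where
  "scalar_matrix M \<longleftrightarrow> (\<exists>c. M = mat c)"

lemma SL_simps [simp]:
  "M \<in> carrier SL \<longleftrightarrow> det M = 1" "M \<otimes>\<^bsub>SL\<^esub> N = M ** N" "\<one>\<^bsub>SL\<^esub> = mat 1"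
  by (simp_all add: SL_def)

lemma group_SL: "group (SL :: ('f::field ^ 'n ^ 'n) monoid)"
proof (rule groupI)
  fix M :: "'f ^ 'n ^ 'n"
  assume "M \<in> carrier SL"
  then have d: "det M = 1" by simp
  then have "invertible M" by (simp add: invertible_det_nz)
  then obtain N where N: "N ** M = mat 1" unfolding invertible_def by blast
  have "det (N ** M) = 1" by (simp add: N)
  then have "det N = 1" by (simp add: det_mul d)
  then show "\<exists>N\<in>carrier SL. N \<otimes>\<^bsub>SL\<^esub> M = \<one>\<^bsub>SL\<^esub>" using N by auto
qed (simp_all add: det_mul matrix_mul_assoc)

context group
begin

lemma conj_class_self: "a \<in> carrier G \<Longrightarrow> a \<in> conj_class G a"
  unfolding conj_class_def by (rule CollectI, rule exI[of _ \<one>]) simp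

lemma conj_class_closed: "a \<in> carrier G \<Longrightarrow> conj_class G a \<subseteq> carrier G"
  unfolding conj_class_def by auto

lemma conj_class_mono:
  assumes "a \<in> carrier G" "x \<in> conj_class G a"
  shows "conj_class G x \<subseteq> conj_class G a"
proof
  fix y assume "y \<in> conj_class G x"
  then obtain c where c: "c \<in> carrier G" "y = inv c \<otimes> x \<otimes> c"
    unfolding conj_class_def by auto
  obtain b where b: "b \<in> carrier G" "x = inv b \<otimes> a \<otimes> b"
    using assms(2) unfolding conj_class_def by auto
  have "y = inv (b \<otimes> c) \<otimes> a \<otimes> (b \<otimes> c)"
    using assms(1) b c by (simp add: inv_mult_group m_assoc)
  then show "y \<in> conj_class G a" using b(1) c(1) unfolding conj_class_def by blast
qed

lemma conj_class_sym:
  assumes "a \<in> carrier G" "x \<in> conj_class G a"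
  shows "a \<in> conj_class G x"
proof -
  obtain b where b: "b \<in> carrier G" "x = inv b \<otimes> a \<otimes> b"
    using assms(2) unfolding conj_class_def by auto
  have "inv (inv b) \<otimes> x \<otimes> inv b = b \<otimes> (inv b \<otimes> (a \<otimes> (b \<otimes> inv b)))"
    using assms(1) b(1) unfolding b(2) by (simp add: m_assoc del: r_inv)
  also have "\<dots> = a"
    using assms(1) b(1) by (simp add: m_assoc[symmetric])
  finally have "a = inv (inv b) \<otimes> x \<otimes> inv b" by (rule sym)
  then show ?thesis using inv_closed[OF b(1)] unfolding conj_class_def by blast
qed

lemma conj_class_eq:
  assumes "a \<in> carrier G" "x \<in> conj_class G a"
  shows "conj_class G x = conj_class G a"
proof
  show "conj_class G x \<subseteq> conj_class G a" by (rule conj_class_mono[OF assms])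
  have "x \<in> carrier G" using assms conj_class_closed by blast
  then show "conj_class G a \<subseteq> conj_class G x"
    by (rule conj_class_mono) (rule conj_class_sym[OF assms])
qed

lemma conj_invariant_class_mult:
  assumes "a \<in> carrier G" "b \<in> carrier G"
  shows "conj_invariant G (conj_class G a <#> conj_class G b)"
  unfolding conj_invariant_def
proof (intro conjI ballI subsetI)
  fix z assume "z \<in> conj_class G a <#> conj_class G b"
  then show "z \<in> carrier G"
    using conj_class_closed[OF assms(1)] conj_class_closed[OF assms(2)]
    unfolding set_mult_def by auto
next
  fix z w
  assume "z \<in> conj_class G a <#> conj_class G b" and w: "w \<in> conj_class G z"
  then obtain x y where xy: "x \<in> conj_class G a" "y \<in> conj_class G b" "z = x \<otimes> y"
    unfolding set_mult_def by auto
  have cl: "x \<in> carrier G" "y \<in> carrier G"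
    using xy conj_class_closed assms by blast+
  obtain c where c: "c \<in> carrier G" "w = inv c \<otimes> z \<otimes> c"
    using w unfolding conj_class_def by auto
  have "inv c \<otimes> x \<otimes> c \<in> conj_class G a" "inv c \<otimes> y \<otimes> c \<in> conj_class G b"
    using conj_class_mono[OF assms(1) xy(1)] conj_class_mono[OF assms(2) xy(2)] c(1)
    unfolding conj_class_def by blast+
  moreover have "w = (inv c \<otimes> x \<otimes> c) \<otimes> (inv c \<otimes> y \<otimes> c)"
  proof -
    have "c \<otimes> (inv c \<otimes> (y \<otimes> c)) = y \<otimes> c"
      using c(1) cl by (simp add: m_assoc[symmetric])
    then show ?thesis using c cl xy(3) by (simp add: m_assoc)
  qed
  ultimately show "w \<in> conj_class G a <#> conj_class G b"
    unfolding set_mult_def by blast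
qed

lemma Union_conj_classes:
  assumes "conj_invariant G X"
  shows "\<Union>{C \<in> conj_classes G. C \<subseteq> X} = X"
proof
  show "X \<subseteq> \<Union>{C \<in> conj_classes G. C \<subseteq> X}"
  proof
    fix x assume x: "x \<in> X"
    then have "x \<in> carrier G" "conj_class G x \<subseteq> X"
      using assms unfolding conj_invariant_def by auto
    then have "conj_class G x \<in> {C \<in> conj_classes G. C \<subseteq> X}" "x \<in> conj_class G x"
      using conj_class_self by (simp_all add: conj_classes_def)
    then show "x \<in> \<Union>{C \<in> conj_classes G. C \<subseteq> X}" by (rule UnionI)
  qed
qed auto

lemma eta_eq_card:
  assumes "K \<subseteq> conj_classes G" "\<Union>K = X"
  shows "eta G X = card K"
proof -
  have "C \<in> K" if C: "C \<in> conj_classes G" "C \<subseteq> X" for C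
  proof -
    obtain a where a: "a \<in> carrier G" "C = conj_class G a"
      using C(1) unfolding conj_classes_def by auto
    have "a \<in> C" using a conj_class_self by simp
    then obtain D where D: "D \<in> K" "a \<in> D" using C(2) assms(2) by blast
    then obtain d where d: "d \<in> carrier G" "D = conj_class G d"
      using assms(1) unfolding conj_classes_def by auto
    have "conj_class G a = conj_class G d" using conj_class_eq d D(2) by blast
    then show ?thesis using a d D by simp
  qed
  moreover have "C \<in> conj_classes G \<and> C \<subseteq> X" if "C \<in> K" for C
    using that assms(1) Union_upper[OF that] assms(2) by auto
  ultimately have "{C \<in> conj_classes G. C \<subseteq> X} = K" by (intro equalityI subsetI) simp_all
  then show ?thesis unfolding eta_def by simp
qed

lemma class_mult_one:
  assumes "b \<in> carrier G"
  shows "conj_class G \<one> <#> conj_class G b = conj_class G (\<one> \<otimes> b)"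
    and "eta G (conj_class G \<one> <#> conj_class G b) = 1"
proof -
  have one: "conj_class G \<one> = {\<one>}"
    unfolding conj_class_def by (auto intro!: exI[of _ \<one>])
  have "\<one> \<otimes> x = x" if "x \<in> conj_class G b" for x
    using that conj_class_closed[OF assms] by auto
  then have *: "conj_class G \<one> <#> conj_class G b = conj_class G b"
    unfolding one set_mult_def by simp
  then show "conj_class G \<one> <#> conj_class G b = conj_class G (\<one> \<otimes> b)"
    using assms by simp
  have "eta G (conj_class G b) = card {conj_class G b}"
    by (rule eta_eq_card) (use assms in \<open>auto simp: conj_classes_def\<close>)
  then show "eta G (conj_class G \<one> <#> conj_class G b) = 1" using * by simp
qed

end

text \<open>Over the field with two elements the bound \<open>2 ^ m - 1\<close> is 1, so every product of classes with
  a scalar (that is, identity) factor satisfies both alternatives of the theorem. The two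
  alternatives can therefore exclude each other only for \<open>m \<ge> 2\<close>.\<close>

lemma alternatives_overlap:
  fixes B :: "'f::{field,finite} ^ 2 ^ 2"
  assumes "CARD('f) = 2 ^ 1" "B \<in> carrier SL"
  shows "conj_class SL (mat 1) <#>\<^bsub>SL\<^esub> conj_class SL B = conj_class SL (mat 1 \<otimes>\<^bsub>SL\<^esub> B)"
    and "scalar_matrix (mat 1 :: 'f ^ 2 ^ 2)"
    and "eta SL (conj_class SL (mat 1) <#>\<^bsub>SL\<^esub> conj_class SL B) \<ge> 2 ^ 1 - 1"
proof -
  note one = group.class_mult_one[OF group_SL assms(2), unfolded SL_simps(3)]
  show "conj_class SL (mat 1) <#>\<^bsub>SL\<^esub> conj_class SL B = conj_class SL (mat 1 \<otimes>\<^bsub>SL\<^esub> B)"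
    by (rule one(1))
  show "scalar_matrix (mat 1 :: 'f ^ 2 ^ 2)"
    unfolding scalar_matrix_def by (rule exI) (rule refl)
  show "eta SL (conj_class SL (mat 1) <#>\<^bsub>SL\<^esub> conj_class SL B) \<ge> 2 ^ 1 - 1"
    unfolding one(2) by simp
qed

end

theory Submission
  imports Defs
begin

text \<open>Conjugacy classes in \<open>SL(2, q)\<close>, \<open>q = 2 ^ m\<close>, are told apart by the trace well enough to count them.
  On the one hand the trace is constant on a class, so a product of two classes contains at least
  as many classes as its elements have traces (\<open>eta_class_mult_ge\<close>). On the other hand a non-scalar
  matrix is conjugate, already within \<open>SL(2, q)\<close>, to the companion matrix of its characteristic
  polynomial (\<open>companion_in_conj_class\<close>): a conjugating matrix in \<open>GL(2, q)\<close> can be rescaled to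
  determinant 1 because every element of the field is a square. Hence, for non-scalar matrices, the
  class is the set of all non-scalar matrices of determinant 1 with the given trace.

  If \<open>A\<close> and \<open>B\<close> are non-scalar with traces \<open>a\<close> and \<open>b\<close>, the traces of the product of their classes
  include the traces of \<open>C ** Y\<close>, where \<open>C\<close> is the companion matrix for \<open>a\<close> and \<open>Y\<close> runs
  over the non-scalar matrices of determinant 1 and trace \<open>b\<close>. Prescribing the trace of \<open>C ** Y\<close> leaves
  one quadratic equation in two unknowns, which has an explicit solution for every value other
  than \<open>a + b\<close> (\<open>ex_factor_with_product_trace\<close>). This gives \<open>q - 1\<close> traces and so alternative (ii).

  In characteristic two the only scalar matrix of determinant 1 is the identity, so a scalar
  factor leads to alternative (i). A product as in (i) is a single class, and \<open>1 < 2 ^ m - 1\<close>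
  for \<open>m \<ge> 2\<close>, which is why the alternatives exclude each other there.\<close>

section \<open>Finite fields of characteristic two\<close>

text \<open>Translation by 1 permutes the field, so it preserves the sum of all elements; yet it adds
  \<open>CARD('f)\<close> to that sum.\<close>

lemma char_two_if_card_power_two:
  assumes "CARD('f::{field,finite}) = 2 ^ m"
  shows "(2::'f) = 0"
proof -
  have "(\<Sum>x\<in>UNIV. x + 1) = (\<Sum>x\<in>UNIV. x::'f)"
    by (rule sum.reindex_bij_witness[where i = "\<lambda>x. x - 1" and j = "\<lambda>x. x + 1"]) auto
  then have "of_nat CARD('f) = (0::'f)"
    by (simp add: sum.distrib)
  then show ?thesis
    by (simp add: assms)
qed

lemma uminus_char_two:
  assumes "(2::'f::field) = 0"
  shows "- x = (x::'f)"
proof -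
  have "x + x = 0" unfolding mult_2[symmetric] assms by simp
  then show ?thesis by (simp add: minus_unique)
qed

lemma add_cancel_char_two:
  assumes "(2::'f::field) = 0"
  shows "x + x = (0::'f)" "x + (x + y) = y" "x - y = x + y"
proof -
  show sum: "x + x = 0" for x :: 'f unfolding mult_2[symmetric] assms by simp
  show "x + (x + y) = y" by (simp add: sum flip: add.assoc)
  show "x - y = x + y" by (metis diff_conv_add_uminus uminus_char_two[OF assms])
qed

lemma eq_if_square_eq_char_two:
  assumes "(2::'f::field) = 0" "x * x = y * y"
  shows "x = (y::'f)"
  using assms(2) uminus_char_two[OF assms(1)] by (simp add: square_eq_iff)

text \<open>Squaring is injective in characteristic two, hence surjective on a finite field.\<close>

lemma ex_sqrt_char_two:
  assumes "(2::'f::{field,finite}) = 0"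
  shows "\<exists>y::'f. y * y = x"
proof -
  have "inj (\<lambda>y::'f. y * y)"
    by (rule injI) (rule eq_if_square_eq_char_two[OF assms])
  then have "surj (\<lambda>y::'f. y * y)"
    by (simp add: finite_UNIV_inj_surj)
  then show ?thesis
    by (metis surjD)
qed

section \<open>Matrices of size two\<close>

definition mat2 :: "'f \<Rightarrow> 'f \<Rightarrow> 'f \<Rightarrow> 'f \<Rightarrow> 'f ^ 2 ^ 2" where
  "mat2 p r s t = (\<chi> i j. if i = 1 then (if j = 1 then p else r) else (if j = 1 then s else t))"

lemma mat2_nth [simp]:
  "mat2 p r s t $ 1 $ 1 = p" "mat2 p r s t $ 1 $ 2 = r"
  "mat2 p r s t $ 2 $ 1 = s" "mat2 p r s t $ 2 $ 2 = t"
  by (simp_all add: mat2_def)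

lemma det_mat2 [simp]: "det (mat2 p r s t) = p * t - r * s" for p :: "'f::field"
  by (simp add: det_2)

lemma trace_2: "trace M = M $ 1 $ 1 + M $ 2 $ 2" for M :: "'f::field ^ 2 ^ 2"
  by (simp add: trace_def sum_2)

lemma matrix_eq_2:
  "M = N \<longleftrightarrow> M $ 1 $ 1 = N $ 1 $ 1 \<and> M $ 1 $ 2 = N $ 1 $ 2
    \<and> M $ 2 $ 1 = N $ 2 $ 1 \<and> M $ 2 $ 2 = N $ 2 $ 2" for M N :: "'f ^ 2 ^ 2"
  by (auto simp: vec_eq_iff forall_2)

lemma matrix_mult_2:
  "(M ** N) $ i $ j = M $ i $ 1 * N $ 1 $ j + M $ i $ 2 * N $ 2 $ j" for M N :: "'f::field ^ 2 ^ 2"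
  by (simp add: matrix_matrix_mult_def sum_2)

lemma scalar_matrix_2_iff:
  "scalar_matrix M \<longleftrightarrow> M $ 1 $ 2 = 0 \<and> M $ 2 $ 1 = 0 \<and> M $ 1 $ 1 = M $ 2 $ 2"
  for M :: "'f::field ^ 2 ^ 2"
  by (auto simp: scalar_matrix_def matrix_eq_2 mat_def)

lemma trace_mat2: "trace (mat2 p r s t) = p + t" for p :: "'f::field"
  by (simp add: trace_2)

section \<open>Conjugacy classes\<close>

lemma trace_conj_class:
  fixes M :: "'f::field ^ 'n ^ 'n"
  assumes M: "M \<in> carrier SL" and X: "X \<in> conj_class SL M"
  shows "trace X = trace M"
proof -
  interpret group "SL :: ('f ^ 'n ^ 'n) monoid" by (rule group_SL)
  obtain Q where Q: "Q \<in> carrier SL" "X = (inv\<^bsub>SL\<^esub> Q ** M) ** Q"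
    using X by (auto simp: conj_class_def)
  have "trace X = trace (Q ** (inv\<^bsub>SL\<^esub> Q ** M))"
    unfolding Q(2) by (rule trace_mul_sym)
  also have "\<dots> = trace ((Q ** inv\<^bsub>SL\<^esub> Q) ** M)"
    by (simp add: matrix_mul_assoc)
  also have "Q ** inv\<^bsub>SL\<^esub> Q = mat 1"
    using r_inv[OF Q(1)] by simp
  finally show ?thesis by simp
qed

text \<open>If \<open>v\<close> is not an eigenvector, then \<open>v\<close> and \<open>M *v v\<close> form a basis in which, by Cayley-Hamilton, \<open>M\<close>
  becomes its companion matrix, whose entry \<open>- det M\<close> is 1 in characteristic two. Replacing \<open>v\<close>
  by a multiple changes the determinant of the base change by a square, so it can be made 1.\<close>

lemma companion_in_conj_class:
  fixes M :: "'f::{field,finite} ^ 2 ^ 2"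
  assumes char: "(2::'f) = 0" and M: "M \<in> carrier SL" and ns: "\<not> scalar_matrix M"
  shows "mat2 0 1 1 (trace M) \<in> conj_class SL M"
proof -
  interpret group "SL :: ('f ^ 2 ^ 2) monoid" by (rule group_SL)
  note minus = uminus_char_two[OF char] and cancel = add_cancel_char_two[OF char]
  obtain p r s t where M_eq: "M = mat2 p r s t"
    by (metis matrix_eq_2 mat2_nth)
  have det: "p * t - r * s = 1" using M by (simp add: M_eq)
  \<comment> \<open>\<open>d x y\<close> is the determinant of the matrix with columns \<open>v = (x, y)\<close> and \<open>M *v v\<close>; if it vanished
    at both unit vectors and at their sum, these would be eigenvectors and \<open>M\<close> scalar.\<close>
  define d where "d x y = x * (s * x + t * y) - y * (p * x + r * y)" for x y
  have "\<exists>x y. d x y \<noteq> 0"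
  proof (rule ccontr)
    assume "\<not> ?thesis"
    then have "d 1 0 = 0" "d 0 1 = 0" "d 1 1 = 0" by blast+
    then show False using ns by (auto simp: d_def scalar_matrix_2_iff M_eq)
  qed
  then obtain x0 y0 where d0: "d x0 y0 \<noteq> 0" by blast
  obtain c where c: "c * c = 1 / d x0 y0" using ex_sqrt_char_two[OF char] by blast
  define x y where "x = c * x0" and "y = c * y0"
  have "d x y = (c * c) * d x0 y0"
    by (simp add: d_def x_def y_def algebra_simps)
  then have d1: "d x y = 1" using c d0 by simp
  define P where "P = mat2 x (p * x + r * y) y (s * x + t * y)"
  let ?C = "mat2 0 1 1 (trace M)"
  have P: "P \<in> carrier SL" using d1 by (simp add: P_def d_def mult.commute)
  have C: "?C \<in> carrier SL" by (simp add: minus)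
  have "M ** P = P ** ?C"
  proof -
    have "p * (p * x + r * y) + r * (s * x + t * y)
        = (p * x + r * y) * (p + t) - (p * t - r * s) * x"
      by (simp add: algebra_simps)
    moreover have "s * (p * x + r * y) + t * (s * x + t * y)
        = (s * x + t * y) * (p + t) - (p * t - r * s) * y"
      by (simp add: algebra_simps)
    ultimately show ?thesis
      by (simp add: matrix_eq_2 matrix_mult_2 P_def M_eq trace_mat2 det[unfolded cancel(3)]
          cancel(3) add.commute)
  qed
  then have "inv\<^bsub>SL\<^esub> P \<otimes>\<^bsub>SL\<^esub> (M \<otimes>\<^bsub>SL\<^esub> P) = inv\<^bsub>SL\<^esub> P \<otimes>\<^bsub>SL\<^esub> (P \<otimes>\<^bsub>SL\<^esub> ?C)"
    by simp
  also have "\<dots> = ?C"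
    using P C by (simp only: m_assoc[symmetric] inv_closed l_inv l_one)
  finally have "?C = inv\<^bsub>SL\<^esub> P \<otimes>\<^bsub>SL\<^esub> M \<otimes>\<^bsub>SL\<^esub> P"
    using P M by (simp only: m_assoc inv_closed)
  then show ?thesis using P unfolding conj_class_def by blast
qed

lemma conj_class_eq_companion:
  fixes M :: "'f::{field,finite} ^ 2 ^ 2"
  assumes "(2::'f) = 0" "M \<in> carrier SL" "\<not> scalar_matrix M"
  shows "conj_class SL M = conj_class SL (mat2 0 1 1 (trace M))"
  using group.conj_class_eq[OF group_SL assms(2) companion_in_conj_class[OF assms]] by simp

section \<open>Traces of products\<close>

text \<open>Let \<open>s\<close> and \<open>t\<close> be the entries of the second row of \<open>Y\<close>. The two trace conditions determine the
  first row, and \<open>det Y = 1\<close> becomes the equation \<open>s\<^sup>2 + t\<^sup>2 + a s t + w s + b t + 1 = 0\<close>. If \<open>a \<noteq> 0\<close>, the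
  choice \<open>s = b / a\<close> cancels the terms linear in \<open>t\<close>, and \<open>t\<close> is found as a square root. If \<open>a = 0\<close>, the
  quadratic part is the square of \<open>s + t\<close>; setting \<open>s + t = 1\<close> leaves the linear equation
  \<open>(w + b) s = b\<close>, solvable because \<open>w \<noteq> b\<close>. For \<open>a \<noteq> 0\<close>, the condition \<open>w \<noteq> a + b\<close> prevents \<open>Y\<close> from being
  the identity, a danger when \<open>b = 0\<close>.\<close>

lemma ex_factor_with_product_trace:
  fixes a b w :: "'f::{field,finite}"
  assumes char: "(2::'f) = 0" and w: "w \<noteq> a + b"
  shows "\<exists>Y :: 'f ^ 2 ^ 2. det Y = 1 \<and> trace Y = b \<and> \<not> scalar_matrix Y
    \<and> trace (mat2 0 1 1 a ** Y) = w"
proof -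
  note cancel = add_cancel_char_two[OF char]
  define Y where "Y s t = mat2 (b + t) (w + s + a * t) s t" for s t
  have trace: "trace (Y s t) = b" "trace (mat2 0 1 1 a ** Y s t) = w" for s t
    unfolding Y_def trace_2 matrix_mult_2 mat2_nth by (simp_all add: cancel ac_simps)
  have "\<exists>s t. det (Y s t) = 1 \<and> \<not> scalar_matrix (Y s t)"
  proof (cases "a = 0")
    case True
    then have wb: "w + b \<noteq> 0" using w uminus_char_two[OF char] by (metis add_0 add_eq_0_iff)
    define s where "s = b / (w + b)"
    have s: "s * (w + b) = b" using wb by (simp add: s_def)
    have "det (Y s (1 + s)) = 1 + (b - s * (w + b)) + ((b * s + s) + (b * s + s))"
      by (simp add: Y_def True algebra_simps)
    then have "det (Y s (1 + s)) = 1"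
      by (simp only: s cancel(1) diff_self add_0_right)
    moreover have "\<not> scalar_matrix (Y s (1 + s))"
      using s wb True by (auto simp: Y_def scalar_matrix_2_iff)
    ultimately show ?thesis by blast
  next
    case False
    define s where "s = b / a"
    have s: "a * s = b" using False by (simp add: s_def)
    obtain t where t: "t * t = 1 + w * s + s * s" using ex_sqrt_char_two[OF char] by blast
    have "det (Y s t) = (t * t - w * s - s * s) + (b - a * s) * t"
      by (simp add: Y_def algebra_simps)
    then have "det (Y s t) = 1"
      by (simp add: s t)
    moreover have "\<not> scalar_matrix (Y s t)"
    proof
      assume "scalar_matrix (Y s t)"
      then have "s = 0" and "w + s + a * t = 0" by (auto simp: Y_def scalar_matrix_2_iff)
      moreover have "t = 1" using t \<open>s = 0\<close> eq_if_square_eq_char_two[OF char, of t 1] by simp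
      ultimately have "w + a = 0" "b = 0" using s by auto
      then show False using w uminus_char_two[OF char, of a] by (metis add_0_right eq_neg_iff_add_eq_0)
    qed
    ultimately show ?thesis by blast
  qed
  then show ?thesis using trace by blast
qed

text \<open>Both the companion matrix for \<open>trace A\<close> and the factor \<open>Y\<close> constructed above lie in the right
  classes, as non-scalar matrices of determinant 1 are classified by their trace.\<close>

lemma ex_trace_in_class_mult:
  fixes A B :: "'f::{field,finite} ^ 2 ^ 2"
  assumes char: "(2::'f) = 0"
    and A: "A \<in> carrier SL" "\<not> scalar_matrix A" and B: "B \<in> carrier SL" "\<not> scalar_matrix B"
    and w: "w \<noteq> trace A + trace B"
  shows "\<exists>Z \<in> conj_class SL A <#>\<^bsub>SL\<^esub> conj_class SL B. trace Z = w"
proof -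
  interpret group "SL :: ('f ^ 2 ^ 2) monoid" by (rule group_SL)
  obtain Y where Y: "det Y = 1" "trace Y = trace B" "\<not> scalar_matrix Y"
    "trace (mat2 0 1 1 (trace A) ** Y) = w"
    using ex_factor_with_product_trace[OF char w] by blast
  have "conj_class SL Y = conj_class SL B"
    using conj_class_eq_companion[OF char B] conj_class_eq_companion[OF char _ Y(3)] Y by simp
  then have "Y \<in> conj_class SL B"
    using conj_class_self[of Y] Y(1) by simp
  then show ?thesis
    using companion_in_conj_class[OF char A] Y(4) unfolding set_mult_def by force
qed

lemma eta_class_mult_ge:
  fixes A B :: "'f::{field,finite} ^ 2 ^ 2"
  assumes char: "(2::'f) = 0"
    and A: "A \<in> carrier SL" "\<not> scalar_matrix A" and B: "B \<in> carrier SL" "\<not> scalar_matrix B"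
  shows "CARD('f) - 1 \<le> eta SL (conj_class SL A <#>\<^bsub>SL\<^esub> conj_class SL B)"
proof -
  interpret group "SL :: ('f ^ 2 ^ 2) monoid" by (rule group_SL)
  let ?W = "UNIV - {trace A + trace B}"
  let ?X = "conj_class SL A <#>\<^bsub>SL\<^esub> conj_class SL B"
  have "\<forall>w\<in>?W. \<exists>Z. Z \<in> ?X \<and> trace Z = w"
    using ex_trace_in_class_mult[OF assms] by blast
  then obtain Z where Z: "\<And>w. w \<in> ?W \<Longrightarrow> Z w \<in> ?X \<and> trace (Z w) = w"
    by (metis bchoice)
  have inv: "conj_invariant SL ?X"
    by (rule conj_invariant_class_mult[OF A(1) B(1)])
  then have carr: "Z w \<in> carrier SL" "conj_class SL (Z w) \<subseteq> ?X" if "w \<in> ?W" for w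
    using Z[OF that] unfolding conj_invariant_def by blast+
  have "card ?W \<le> card {C \<in> conj_classes SL. C \<subseteq> ?X}"
  proof (rule card_inj_on_le)
    show "inj_on (\<lambda>w. conj_class SL (Z w)) ?W"
    proof (rule inj_onI)
      fix v w assume v: "v \<in> ?W" and w: "w \<in> ?W" and eq: "conj_class SL (Z v) = conj_class SL (Z w)"
      have "Z v \<in> conj_class SL (Z w)"
        using conj_class_self[OF carr(1)[OF v]] eq by simp
      then have "trace (Z v) = trace (Z w)"
        by (rule trace_conj_class[OF carr(1)[OF w]])
      then show "v = w" using Z v w by simp
    qed
    show "(\<lambda>w. conj_class SL (Z w)) ` ?W \<subseteq> {C \<in> conj_classes SL. C \<subseteq> ?X}"
      using carr by (auto simp: conj_classes_def simp del: SL_simps)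
  qed simp
  then show ?thesis by (simp add: eta_def card_Diff_singleton)
qed

section \<open>Scalar factors\<close>

lemma (in group) eta_conj_class:
  assumes "a \<in> carrier G"
  shows "eta G (conj_class G a) = 1"
  using class_mult_one[OF assms] assms by simp

lemma (in group) class_mult_one_right:
  assumes "a \<in> carrier G"
  shows "conj_class G a <#> conj_class G \<one> = conj_class G a"
proof -
  have "conj_class G \<one> = {\<one>}"
    unfolding conj_class_def by (auto intro!: exI[of _ \<one>])
  moreover have "x \<otimes> \<one> = x" if "x \<in> conj_class G a" for x
    using that conj_class_closed[OF assms] by auto
  ultimately show ?thesis
    unfolding set_mult_def by simp
qed

lemma scalar_matrix_SL_2_char_two:
  fixes M :: "'f::field ^ 2 ^ 2"
  assumes char: "(2::'f) = 0" and "M \<in> carrier SL" "scalar_matrix M"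
  shows "M = mat 1"
proof -
  obtain c where c: "M = mat c" using assms(3) by (auto simp: scalar_matrix_def)
  then have "c * c = 1" using assms(2) by (simp add: det_2 mat_def)
  then have "c = 1" using eq_if_square_eq_char_two[OF char, of c 1] by simp
  then show ?thesis using c by simp
qed

section \<open>The dichotomy\<close>

theorem theoremA:
  fixes A B :: "'f::{field,finite} ^ 2 ^ 2" and m :: nat
  assumes "m > 0"
    and "CARD('f) = 2 ^ m"
    and "A \<in> carrier SL" and "B \<in> carrier SL"
  shows "let i = (conj_class SL A <#>\<^bsub>SL\<^esub> conj_class SL B = conj_class SL (A \<otimes>\<^bsub>SL\<^esub> B)
                  \<and> (scalar_matrix A \<or> scalar_matrix B));
             ii = (eta SL (conj_class SL A <#>\<^bsub>SL\<^esub> conj_class SL B) \<ge> 2 ^ m - 1)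
         in (i \<or> ii) \<and> (m \<ge> 2 \<longrightarrow> \<not> (i \<and> ii))"
proof -
  interpret group "SL :: ('f ^ 2 ^ 2) monoid" by (rule group_SL)
  let ?X = "conj_class SL A <#>\<^bsub>SL\<^esub> conj_class SL B"
  have char: "(2::'f) = 0" using assms(2) by (rule char_two_if_card_power_two)
  have scalar: "?X = conj_class SL (A \<otimes>\<^bsub>SL\<^esub> B)" if "scalar_matrix A \<or> scalar_matrix B"
    using that
  proof
    assume "scalar_matrix A"
    then have "A = \<one>\<^bsub>SL\<^esub>"
      using scalar_matrix_SL_2_char_two[OF char assms(3)] by simp
    then show ?thesis using class_mult_one(1)[OF assms(4)] by simp
  next
    assume "scalar_matrix B"
    then have "B = \<one>\<^bsub>SL\<^esub>"
      using scalar_matrix_SL_2_char_two[OF char assms(4)] by simp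
    then show ?thesis using class_mult_one_right[OF assms(3)] by simp
  qed
  have nonscalar: "2 ^ m - 1 \<le> eta SL ?X" if "\<not> scalar_matrix A" "\<not> scalar_matrix B"
    using eta_class_mult_ge[OF char assms(3) that(1) assms(4) that(2)] assms(2) by simp
  have exclusive: "\<not> 2 ^ m - 1 \<le> eta SL ?X"
    if "m \<ge> 2" and eq: "?X = conj_class SL (A \<otimes>\<^bsub>SL\<^esub> B)"
  proof -
    have "eta SL ?X = 1"
      unfolding eq using assms(3,4) by (intro eta_conj_class m_closed)
    moreover have "(2::nat) ^ 2 \<le> 2 ^ m"
      using that(1) by (intro power_increasing) simp_all
    ultimately show ?thesis by simp
  qed
  show ?thesis
    unfolding Let_def using scalar nonscalar exclusive by blast
qed

end
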